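(* Let $(X,\leq)$ be a finite partially ordered set, and let $\mathcal{U}_{\leq}$ be the family of all subsets $U\subseteq X$ such that whenever $x\in U$ and $y\geq x$, also $y\in U$. Then $\mathcal{U}_{\leq}$ is a topology on $X$ and $(X,\mathcal{U}_{\leq})$ is a finite $T_0$ space.
   Context: A subset $U$ of a partially ordered set $(X,\leq)$ is called open if whenever $x\in U$ and $y\geq x$ it is also the case that $y\in U$; $\mathcal{U}_{\leq}$ denotes the set of all open subsets in this sense. *)

theory Defs
  imports "HOL-Analysis.Analysis"
begin

text \<open>
  The order is a relation on a carrier set: \<open>(x, y) \<in> r\<close> stands for \<open>x \<le> y\<close>.
\<close>

definition order_open_sets :: "'a set \<Rightarrow> 'a rel \<Rightarrow> 'a set set" where
  "order_open_sets X r = {U. U \<subseteq> X \<and> (\<forall>x\<in>U. \<forall>y\<in>X. (x, y) \<in> r \<longrightarrow> y \<in> U)}"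

text \<open>
  \<^const>\<open>topology\<close> yields a topology with the given open sets only for arguments satisfying
  \<^const>\<open>istopology\<close>; any use of this definition should be accompanied by that fact.
\<close>

definition order_topology_on :: "'a set \<Rightarrow> 'a rel \<Rightarrow> 'a topology" where
  "order_topology_on X r = topology (\<lambda>U. U \<in> order_open_sets X r)"

end

theory Submission
  imports Defs
begin

text \<open>Up-sets are stable under unions and intersections, which gives the topology. For T_0,
  take distinct points: by antisymmetry one of them is not below the other, and its principal up-set
  separates the two. Reflexivity puts the point in this set, and transitivity makes the set open
  (\<open>up_set_in_order_open_sets\<close>).\<close>

lemma istopology_order_open_sets: "istopology (\<lambda>U. U \<in> order_open_sets X r)"
  unfolding istopology_def order_open_sets_def by blast

lemma openin_order_topology_on:
  "openin (order_topology_on X r) U \<longleftrightarrow> U \<in> order_open_sets X r"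
  by (simp add: order_topology_on_def topology_inverse'[OF istopology_order_open_sets])

text \<open>The whole carrier is an up-set, and every open set lies inside it.\<close>

lemma topspace_order_topology_on: "topspace (order_topology_on X r) = X"
proof -
  have "\<Union>(order_open_sets X r) = X"
    unfolding order_open_sets_def by blast
  then show ?thesis
    by (simp add: topspace_def openin_order_topology_on)
qed

lemma up_set_in_order_open_sets:
  assumes "trans r"
  shows "{z \<in> X. (x, z) \<in> r} \<in> order_open_sets X r"
  using assms unfolding order_open_sets_def by (auto dest: transD)

lemma t0_space_order_topology_on:
  assumes "partial_order_on X r"
  shows "t0_space (order_topology_on X r)"
proof -
  have refl: "refl_on X r" and trans: "trans r" and antisym: "antisym r"
    using assms by (auto simp: partial_order_on_def preorder_on_def)
  \<comment> \<open>The biconditional says that \<open>U\<close> contains exactly one of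
    \<open>x\<close> and \<open>y\<close>.\<close>
  have "\<exists>U. U \<in> order_open_sets X r \<and> (x \<notin> U \<longleftrightarrow> y \<in> U)"
    if xy: "x \<in> X" "y \<in> X" "x \<noteq> y" for x y
  proof -
    have "(x, x) \<in> r" "(y, y) \<in> r"
      using refl xy by (auto dest: refl_onD)
    moreover have "(x, y) \<notin> r \<or> (y, x) \<notin> r"
      using antisym xy by (auto dest: antisymD)
    \<comment> \<open>If \<open>(x, y) \<notin> r\<close>, the up-set of \<open>x\<close> contains
      \<open>x\<close> but misses \<open>y\<close>; if \<open>(y, x) \<notin> r\<close>, the up-set
      of \<open>y\<close> does the job.\<close>
    ultimately have "(x \<notin> {z \<in> X. (x, z) \<in> r} \<longleftrightarrow> y \<in> {z \<in> X. (x, z) \<in> r})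
        \<or> (x \<notin> {z \<in> X. (y, z) \<in> r} \<longleftrightarrow> y \<in> {z \<in> X. (y, z) \<in> r})"
      using xy by blast
    then show ?thesis
      using up_set_in_order_open_sets[OF trans] by blast
  qed
  then show ?thesis
    by (simp add: t0_space_def topspace_order_topology_on openin_order_topology_on)
qed

theorem proposition2p5:
  fixes X :: "'a set" and r :: "'a rel"
  assumes "finite X" and "partial_order_on X r"
  shows "istopology (\<lambda>U. U \<in> order_open_sets X r)
    \<and> topspace (order_topology_on X r) = X
    \<and> finite (topspace (order_topology_on X r))
    \<and> t0_space (order_topology_on X r)"
  using assms
  by (simp add: istopology_order_open_sets topspace_order_topology_on t0_space_order_topology_on)

end
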